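(* Let $X$ be a normed vector space and let $V\subset X$ be a closed convex pointed cone. Then the family of all nonempty weakly narrow closed convex subsets $A$ of $X$ with $\operatorname{recc}A=V$, equipped with the addition $A\dot{+}B:=\operatorname{cl}(A+B)$ and multiplication by non-negative numbers ($\lambda A=\{\lambda a:a\in A\}$ for $\lambda>0$ and $0\cdot A:=V$), is an abstract convex cone having $V$ as neutral element and satisfying the cancellation law.
   Context: Normed spaces are real. $A+B=\{a+b:a\in A,b\in B\}$. The recession cone of $A\subset X$ is $\operatorname{recc}A=\{x\in X: a+tx\in A\text{ for all }a\in A,\ t\geqslant 0\}$. A cone $V$ is pointed if $V\cap(-V)=\{0\}$. A set $A\subset X$ is weakly narrow if every sequence $(x_n)\subset A$ with $\|x_n\|\to\infty$ has a subsequence $(x_{n_k})$ such that $x_{n_k}/\|x_{n_k}\|$ converges weakly to a point other than the origin. An abstract convex cone is a set $S$ with operations $+:S\times S\to S$ and $\cdot:\mathbb{R}_+\times S\to S$ such that $+$ is associative and commutative with a neutral element $0$, and $1\cdot a=a$, $\alpha(\beta a)=(\alpha\beta)a$, $\alpha(a+b)=\alpha a+\alpha b$, $(\alpha+\beta)a=\alpha a+\beta a$, $0\cdot a=0$ for all $\alpha,\beta\geqslant 0$ and $a,b\in S$. The cancellation law is: $A\dot{+}B=B\dot{+}C$ implies $A=C$.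
   Formalization: The formal statement additionally assumes that the family is nonempty; otherwise the claim fails, e.g. for the nonnegative sequences in l^2, where the family is empty and so does not contain V as neutral element. *)

theory Defs
  imports "HOL-Analysis.Analysis"
begin

definition recession_cone :: "'a::real_vector set \<Rightarrow> 'a set"
  where "recession_cone A = {x. \<forall>a\<in>A. \<forall>t\<ge>0. a + t *\<^sub>R x \<in> A}"

definition pointed :: "'a::real_vector set \<Rightarrow> bool"
  where "pointed V \<longleftrightarrow> V \<inter> uminus ` V = {0}"

definition weakly_converges :: "(nat \<Rightarrow> 'a::real_normed_vector) \<Rightarrow> 'a \<Rightarrow> bool"
  where "weakly_converges x l \<longleftrightarrow>
    (\<forall>f :: 'a \<Rightarrow> real. bounded_linear f \<longrightarrow> (\<lambda>n. f (x n)) \<longlonglongrightarrow> f l)"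

(* A normalised term with x (r k) = 0 is 0 by the convention for inverse; as the norms tend to
   infinity, this affects only finitely many terms. *)
definition weakly_narrow :: "'a::real_normed_vector set \<Rightarrow> bool"
  where "weakly_narrow A \<longleftrightarrow>
    (\<forall>x :: nat \<Rightarrow> 'a. range x \<subseteq> A \<and> filterlim (\<lambda>n. norm (x n)) at_top sequentially \<longrightarrow>
      (\<exists>(r :: nat \<Rightarrow> nat) l. strict_mono r \<and> l \<noteq> 0 \<and>
        weakly_converges (\<lambda>k. x (r k) /\<^sub>R norm (x (r k))) l))"

(* The operations are total functions on the type; only their restriction to the carrier S and,
   for scalars, to the non-negative reals is constrained. *)
locale abstract_convex_cone =
  fixes S :: "'s set"
    and plus :: "'s \<Rightarrow> 's \<Rightarrow> 's"  (infixl \<open>\<oplus>\<close> 65)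
    and smult :: "real \<Rightarrow> 's \<Rightarrow> 's"  (infixr \<open>\<odot>\<close> 75)
    and zero :: 's  (\<open>\<zero>\<close>)
  assumes plus_closed: "\<lbrakk>a \<in> S; b \<in> S\<rbrakk> \<Longrightarrow> a \<oplus> b \<in> S"
    and smult_closed: "\<lbrakk>0 \<le> \<alpha>; a \<in> S\<rbrakk> \<Longrightarrow> \<alpha> \<odot> a \<in> S"
    and zero_closed: "\<zero> \<in> S"
    and plus_assoc: "\<lbrakk>a \<in> S; b \<in> S; c \<in> S\<rbrakk> \<Longrightarrow> (a \<oplus> b) \<oplus> c = a \<oplus> (b \<oplus> c)"
    and plus_commute: "\<lbrakk>a \<in> S; b \<in> S\<rbrakk> \<Longrightarrow> a \<oplus> b = b \<oplus> a"
    and plus_zero: "a \<in> S \<Longrightarrow> a \<oplus> \<zero> = a"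
    and one_smult: "a \<in> S \<Longrightarrow> 1 \<odot> a = a"
    and smult_smult: "\<lbrakk>0 \<le> \<alpha>; 0 \<le> \<beta>; a \<in> S\<rbrakk> \<Longrightarrow> \<alpha> \<odot> (\<beta> \<odot> a) = (\<alpha> * \<beta>) \<odot> a"
    and smult_plus: "\<lbrakk>0 \<le> \<alpha>; a \<in> S; b \<in> S\<rbrakk> \<Longrightarrow> \<alpha> \<odot> (a \<oplus> b) = (\<alpha> \<odot> a) \<oplus> (\<alpha> \<odot> b)"
    and add_smult: "\<lbrakk>0 \<le> \<alpha>; 0 \<le> \<beta>; a \<in> S\<rbrakk> \<Longrightarrow> (\<alpha> + \<beta>) \<odot> a = (\<alpha> \<odot> a) \<oplus> (\<beta> \<odot> a)"
    and zero_smult: "a \<in> S \<Longrightarrow> 0 \<odot> a = \<zero>"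

(* Possibly empty: for the cone V of non-negative sequences in l^2, every A with recession cone V
   contains the sequence a + n e_n, whose normalisation tends weakly to 0.  The family is nonempty
   iff V is itself a member, for V a closed convex pointed cone. *)
definition narrow_family :: "'a::real_normed_vector set \<Rightarrow> 'a set set"
  where "narrow_family V =
    {A. A \<noteq> {} \<and> weakly_narrow A \<and> closed A \<and> convex A \<and> recession_cone A = V}"

definition closed_sum :: "'a::real_normed_vector set \<Rightarrow> 'a set \<Rightarrow> 'a set"
  where "closed_sum A B = closure (A + B)"

definition set_scale :: "'a::real_vector set \<Rightarrow> real \<Rightarrow> 'a set \<Rightarrow> 'a set"
  where "set_scale V c A = (if c = 0 then V else (\<lambda>a. c *\<^sub>R a) ` A)"

end

theory Submission
  imports Defs
begin

text \<open>
Let \<^term>\<open>V\<close> be a closed convex pointed cone. A weakly narrow closed convex set with recession cone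
\<^term>\<open>V\<close> is, seen from far away, close to \<^term>\<open>V\<close>: an unbounded sequence in it has a subsequence whose
normalised terms tend weakly to a nonzero point, and this point is a recession direction
(\<open>weak_limit_in_recession_cone\<close>). Pointedness says that two such directions never cancel. Hence if
\<open>a\<^sub>n\<close> and \<open>b\<^sub>n\<close> come from two such sets and at least one of them is large, then \<open>a\<^sub>n + b\<^sub>n\<close> is large as well,
of the order of the sum of the two norms, and along a subsequence its direction tends weakly to a nonzero
point of \<^term>\<open>V\<close> (\<open>sum_scaled_limit\<close>). This compensates for the lack of compactness, and it gives at once
that the closed sum is weakly narrow and that its recession cone is not larger than \<^term>\<open>V\<close>.

The cancellation law adapts the classical argument for a bounded summand. If \<open>a + B\<close> lies in the closure
of \<open>B + C\<close>, iterating this inclusion from a point \<open>b\<^sub>0\<close> of \<open>B\<close> yields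
\<open>a \<approx> m\<^sub>n + (b\<^sub>n - b\<^sub>0) / n\<close> with means \<open>m\<^sub>n\<close> of points of \<open>C\<close> (\<open>iterated_absorption\<close>). For bounded \<open>B\<close> the last
term vanishes. Here \<open>b\<^sub>n / n\<close> may persist, but only in a direction of \<^term>\<open>V\<close>: it cannot outgrow \<open>n\<close>,
since then \<open>m\<^sub>n\<close> would have to escape to infinity in the opposite direction, against pointedness, and a
weak limit \<open>v\<close> in \<^term>\<open>V\<close> of \<open>b\<^sub>n / n\<close> gives \<open>a - v\<close> in \<open>C\<close>, hence \<open>a\<close> in \<open>C\<close> (\<open>order_cancellation\<close>).
Applied in both directions this yields equality.

Weak limits enter through two facts: closed convex sets contain the weak limits of their sequences,
and weak limits are unique. Both follow from the separation of a point from a closed convex set. The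
functional is found below a suitable sublinear one, since minimal sublinear functionals are linear.

That the cone \<^term>\<open>V\<close> is itself weakly narrow, and so a neutral element inside the family, follows from
the existence of any member: the member contains a translate of \<^term>\<open>V\<close>. The remaining laws are
identities for Minkowski sums and closures.
\<close>

section \<open>Sublinear functionals and separation\<close>
definition sublinear :: "('a::real_vector \<Rightarrow> real) \<Rightarrow> bool"
  where "sublinear p \<longleftrightarrow>
    (\<forall>x y. p (x + y) \<le> p x + p y) \<and> (\<forall>c\<ge>0. \<forall>x. p (c *\<^sub>R x) \<le> c * p x)"

lemma sublinearI:
  assumes "\<And>x y. p (x + y) \<le> p x + p y" and "\<And>c x. 0 \<le> c \<Longrightarrow> p (c *\<^sub>R x) \<le> c * p x"
  shows "sublinear p"
  using assms by (auto simp: sublinear_def)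

lemma sublinear_add: "sublinear p \<Longrightarrow> p (x + y) \<le> p x + p y"
  by (simp add: sublinear_def)

lemma sublinear_scale: "sublinear p \<Longrightarrow> 0 \<le> c \<Longrightarrow> p (c *\<^sub>R x) \<le> c * p x"
  by (simp add: sublinear_def)

lemma sublinear_zero: "sublinear p \<Longrightarrow> p 0 = 0"
  using sublinear_add[of p 0 0] sublinear_scale[of p 0 0] by simp

lemma sublinear_minus_le: "sublinear p \<Longrightarrow> - p (- x) \<le> p x"
  using sublinear_add[of p x "- x"] sublinear_zero[of p] by simp

lemma sublinear_norm: "sublinear norm"
  by (simp add: sublinearI norm_triangle_ineq)

lemma le_Inf_add_Inf:
  fixes S T :: "real set"
  assumes "S \<noteq> {}" and "T \<noteq> {}" and le: "\<And>v w. v \<in> S \<Longrightarrow> w \<in> T \<Longrightarrow> m \<le> v + w"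
  shows "m \<le> Inf S + Inf T"
proof -
  have "m - w \<le> Inf S" if "w \<in> T" for w
    using le[OF _ that] by (intro cInf_greatest[OF \<open>S \<noteq> {}\<close>]) (simp add: algebra_simps)
  then have "m - Inf S \<le> w" if "w \<in> T" for w
    using that by (simp add: algebra_simps)
  from cInf_greatest[OF \<open>T \<noteq> {}\<close> this] show ?thesis
    by simp
qed

lemma le_mult_Inf:
  fixes S :: "real set"
  assumes "S \<noteq> {}" and "0 \<le> c" and le: "\<And>v. v \<in> S \<Longrightarrow> m \<le> c * v"
  shows "m \<le> c * Inf S"
proof (cases "c = 0")
  case True
  then show ?thesis using \<open>S \<noteq> {}\<close> le by force
next
  case False
  with \<open>0 \<le> c\<close> have "0 < c" by simp
  have "m / c \<le> Inf S"
    using le \<open>0 < c\<close> by (intro cInf_greatest[OF \<open>S \<noteq> {}\<close>]) (simp add: field_simps)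
  then show ?thesis using \<open>0 < c\<close> by (simp add: field_simps)
qed

text \<open>Replacing \<^term>\<open>q x\<close> by the infimum of the values \<^term>\<open>q (x + k) - s\<close> over a convex cone of pairs
\<^term>\<open>(k, s)\<close> keeps sublinearity, since the pairs can be added and rescaled along with the arguments.
The domination \<^term>\<open>s \<le> q k\<close> keeps the infimum finite. The new functional is at most \<^term>\<open>- s\<close>
at \<^term>\<open>- k\<close>, so a linear functional below it is at least \<^term>\<open>s\<close> at \<^term>\<open>k\<close>: the cone prescribes lower
bounds for linear functionals. It serves twice, to show that minimal sublinear functionals are linear
and to separate a point from a convex set.\<close>
lemma sublinear_minorant:
  fixes q :: "'a::real_vector \<Rightarrow> real" and K :: "('a \<times> real) set"
  assumes q: "sublinear q"
    and zero: "(0, 0) \<in> K"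
    and add: "\<And>k s l t. (k, s) \<in> K \<Longrightarrow> (l, t) \<in> K \<Longrightarrow> (k + l, s + t) \<in> K"
    and scale: "\<And>c k s. 0 \<le> c \<Longrightarrow> (k, s) \<in> K \<Longrightarrow> (c *\<^sub>R k, c * s) \<in> K"
    and dom: "\<And>k s. (k, s) \<in> K \<Longrightarrow> s \<le> q k"
  obtains p where "sublinear p" and "\<And>x. p x \<le> q x"
    and "\<And>x k s. (k, s) \<in> K \<Longrightarrow> p x \<le> q (x + k) - s"
proof -
  define W where "W x = {q (x + k) - s |k s. (k, s) \<in> K}" for x
  define p where "p x = Inf (W x)" for x
  have ne: "W x \<noteq> {}" for x
    using zero by (auto simp: W_def)
  have "- q (- x) \<le> w" if "w \<in> W x" for x w
  proof -
    from that obtain k s where "(k, s) \<in> K" and w: "w = q (x + k) - s"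
      by (auto simp: W_def)
    then have "s \<le> q k" by (intro dom)
    also have "q k \<le> q (x + k) + q (- x)"
      using sublinear_add[OF q, of "x + k" "- x"] by simp
    finally show ?thesis using w by simp
  qed
  then have bdd: "bdd_below (W x)" for x
    by (meson bdd_belowI)
  have le: "p x \<le> q (x + k) - s" if "(k, s) \<in> K" for x k s
    unfolding p_def using that by (intro cInf_lower bdd) (auto simp: W_def)
  have "sublinear p"
  proof (rule sublinearI)
    fix x y
    show "p (x + y) \<le> p x + p y"
      unfolding p_def[of x] p_def[of y]
    proof (rule le_Inf_add_Inf[OF ne ne])
      fix v w assume "v \<in> W x" "w \<in> W y"
      then obtain k s l t where *: "(k, s) \<in> K" "v = q (x + k) - s" "(l, t) \<in> K" "w = q (y + l) - t"
        by (auto simp: W_def)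
      have "p (x + y) \<le> q (x + y + (k + l)) - (s + t)"
        by (intro le add *)
      also have "\<dots> \<le> v + w"
        using sublinear_add[OF q, of "x + k" "y + l"] * by (simp add: algebra_simps)
      finally show "p (x + y) \<le> v + w" .
    qed
  next
    fix c :: real and x assume c: "0 \<le> c"
    show "p (c *\<^sub>R x) \<le> c * p x"
      unfolding p_def[of x]
    proof (rule le_mult_Inf[OF ne c])
      fix v assume "v \<in> W x"
      then obtain k s where *: "(k, s) \<in> K" "v = q (x + k) - s"
        by (auto simp: W_def)
      have "p (c *\<^sub>R x) \<le> q (c *\<^sub>R x + c *\<^sub>R k) - c * s"
        by (intro le scale * c)
      also have "\<dots> \<le> c * v"
        using sublinear_scale[OF q c, of "x + k"] * by (simp add: scaleR_add_right right_diff_distrib)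
      finally show "p (c *\<^sub>R x) \<le> c * v" .
    qed
  qed
  moreover have "p x \<le> q x" for x
    using le[OF zero, of x] by simp
  ultimately show thesis
    using that le by blast
qed

text \<open>The pointwise infimum of a chain is finite because every \<^term>\<open>q \<le> p\<close> satisfies
\<^term>\<open>- p (- x) \<le> - q (- x)\<close> and \<^term>\<open>- q (- x) \<le> q x\<close>. It is subadditive because two members of a chain
have a common lower bound in the chain.\<close>
lemma sublinear_INF_chain:
  fixes p :: "'a::real_vector \<Rightarrow> real"
  assumes sub: "\<And>q. q \<in> C \<Longrightarrow> sublinear q \<and> q \<le> p" and "C \<noteq> {}"
    and chain: "\<And>q r. q \<in> C \<Longrightarrow> r \<in> C \<Longrightarrow> q \<le> r \<or> r \<le> q"
  obtains u where "sublinear u" and "\<And>q. q \<in> C \<Longrightarrow> u \<le> q"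
proof -
  define u where "u x = (INF q\<in>C. q x)" for x
  have "- p (- x) \<le> q x" if "q \<in> C" for q x
    using sub[OF that] sublinear_minus_le[of q x] by (smt (verit) le_fun_def)
  then have bdd: "bdd_below ((\<lambda>q. q x) ` C)" for x
    by (meson bdd_belowI2)
  have le: "u x \<le> q x" if "q \<in> C" for q x
    unfolding u_def by (intro cINF_lower bdd that)
  have ne: "(\<lambda>q. q x) ` C \<noteq> {}" for x
    using \<open>C \<noteq> {}\<close> by simp
  have "sublinear u"
  proof (rule sublinearI)
    fix x y
    show "u (x + y) \<le> u x + u y"
      unfolding u_def[of x] u_def[of y]
    proof (rule le_Inf_add_Inf[OF ne ne])
      fix v w assume "v \<in> (\<lambda>q. q x) ` C" "w \<in> (\<lambda>q. q y) ` C"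
      then obtain q r where *: "q \<in> C" "r \<in> C" "v = q x" "w = r y"
        by auto
      then obtain m where m: "m \<in> C" "m \<le> q" "m \<le> r"
        using chain by blast
      have "u (x + y) \<le> m x + m y"
        using le[OF m(1), of "x + y"] sub[OF m(1)] sublinear_add[of m x y] by linarith
      also have "\<dots> \<le> v + w"
        using m * by (simp add: le_fun_def add_mono)
      finally show "u (x + y) \<le> v + w" .
    qed
  next
    fix c :: real and x assume c: "0 \<le> c"
    show "u (c *\<^sub>R x) \<le> c * u x"
      unfolding u_def[of x]
    proof (rule le_mult_Inf[OF ne c])
      fix v assume "v \<in> (\<lambda>q. q x) ` C"
      then obtain q where "q \<in> C" "v = q x"
        by auto
      then show "u (c *\<^sub>R x) \<le> c * v"
        using le[of q "c *\<^sub>R x"] sub[of q] sublinear_scale[of q c x] c by simp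
    qed
  qed
  with le that show thesis
    by (simp add: le_fun_def)
qed

text \<open>Minimality forces additivity: lowering \<^term>\<open>q\<close> along the ray through \<^term>\<open>y\<close> with slope \<^term>\<open>q y\<close> gives a
sublinear functional below \<^term>\<open>q\<close>, hence \<^term>\<open>q\<close> itself, and its bound at the single pair
\<^term>\<open>(y, q y)\<close> reads \<^term>\<open>q x + q y \<le> q (x + y)\<close>.\<close>
lemma minimal_sublinear_linear:
  fixes q :: "'a::real_vector \<Rightarrow> real"
  assumes q: "sublinear q" and min: "\<And>r. sublinear r \<Longrightarrow> r \<le> q \<Longrightarrow> r = q"
  shows "linear q"
proof -
  have add: "q (x + y) = q x + q y" for x y
  proof -
    \<comment> \<open>The graph of the linear functional with value \<^term>\<open>q y\<close> at \<^term>\<open>y\<close>, on a half-line.\<close>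
    let ?K = "{(t *\<^sub>R y, t * q y) |t. 0 \<le> t}"
    have hom: "t * q y \<le> q (t *\<^sub>R y)" if "0 \<le> t" for t
    proof (cases "t = 0")
      case False
      with that sublinear_scale[OF q, of "inverse t" "t *\<^sub>R y"] show ?thesis
        by (simp add: field_simps)
    qed (simp add: sublinear_zero[OF q])
    obtain r where r: "sublinear r" "\<And>x. r x \<le> q x"
      and rK: "\<And>x k s. (k, s) \<in> ?K \<Longrightarrow> r x \<le> q (x + k) - s"
    proof (rule sublinear_minorant[OF q, of ?K])
      show "(0, 0) \<in> ?K"
        by (intro CollectI exI[of _ 0]) simp
      fix k l s t assume "(k, s) \<in> ?K" "(l, t) \<in> ?K"
      then obtain a b where "0 \<le> a" "k = a *\<^sub>R y" "s = a * q y" "0 \<le> b" "l = b *\<^sub>R y" "t = b * q y"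
        by auto
      then have "k + l = (a + b) *\<^sub>R y \<and> s + t = (a + b) * q y \<and> 0 \<le> a + b"
        by (simp add: algebra_simps)
      then show "(k + l, s + t) \<in> ?K" by blast
    next
      fix c k s assume "0 \<le> (c::real)" "(k, s) \<in> ?K"
      then obtain a where "0 \<le> a" "k = a *\<^sub>R y" "s = a * q y" by auto
      then have "c *\<^sub>R k = (c * a) *\<^sub>R y \<and> c * s = (c * a) * q y \<and> 0 \<le> c * a"
        using \<open>0 \<le> c\<close> by simp
      then show "(c *\<^sub>R k, c * s) \<in> ?K" by blast
    next
      fix k s assume "(k, s) \<in> ?K"
      then show "s \<le> q k" using hom by auto
    qed blast
    have "r = q"
      by (rule min) (auto simp: r le_fun_def)
    moreover have "(y, q y) \<in> ?K"
      by (intro CollectI exI[of _ 1]) simp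
    ultimately have "q x \<le> q (x + y) - q y"
      using rK[of y "q y" x] by simp
    with sublinear_add[OF q, of x y] show ?thesis by linarith
  qed
  have neg: "q (- x) = - q x" for x
    using add[of x "- x"] sublinear_zero[OF q] by simp
  have le: "q (c *\<^sub>R x) \<le> c * q x" if "0 \<le> c" for c x
    using sublinear_scale[OF q that] .
  have pos: "q (c *\<^sub>R x) = c * q x" if "0 \<le> c" for c x
    using le[OF that, of x] le[OF that, of "- x"] by (simp add: neg)
  have "q (c *\<^sub>R x) = c * q x" for c x
    using pos[of c x] pos[of "- c" x] by (cases "0 \<le> c") (auto simp: neg)
  with add show ?thesis
    by (intro linearI) auto
qed

text \<open>The Hahn--Banach theorem in its sublinear form, by Zorn's lemma for the pointwise order.\<close>
lemma linear_below_sublinear: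
  fixes p :: "'a::real_vector \<Rightarrow> real"
  assumes p: "sublinear p"
  obtains f where "linear f" and "\<And>x. f x \<le> p x"
proof -
  define A where "A = {q. sublinear q \<and> q \<le> p}"
  have "\<exists>m\<in>A. \<forall>a\<in>A. a \<le> m \<longrightarrow> a = m"
  proof (rule predicate_Zorn)
    show "partial_order_on A (relation_of (\<lambda>x y. y \<le> x) A)"
      by (rule partial_order_on_relation_ofI) auto
    fix C assume C: "C \<in> Chains (relation_of (\<lambda>x y. y \<le> x) A)"
    show "\<exists>u\<in>A. \<forall>a\<in>C. u \<le> a"
    proof (cases "C = {}")
      case True
      with p show ?thesis by (auto simp: A_def)
    next
      case False
      from C have sub: "q \<in> C \<Longrightarrow> sublinear q \<and> q \<le> p" for q
        by (auto simp: Chains_def relation_of_def A_def)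
      from C have "q \<in> C \<Longrightarrow> r \<in> C \<Longrightarrow> q \<le> r \<or> r \<le> q" for q r
        by (auto simp: Chains_def relation_of_def)
      from sublinear_INF_chain[OF sub False this]
      obtain u where u: "sublinear u" "\<And>q. q \<in> C \<Longrightarrow> u \<le> q"
        by blast
      with False sub have "u \<le> p"
        by (metis equals0I order_trans)
      with u show ?thesis by (auto simp: A_def)
    qed
  qed
  then obtain m where m: "sublinear m" "m \<le> p" and min: "\<And>a. a \<in> A \<Longrightarrow> a \<le> m \<Longrightarrow> a = m"
    by (auto simp: A_def)
  have "linear m"
  proof (rule minimal_sublinear_linear[OF m(1)])
    fix r assume "sublinear r" "r \<le> m"
    with m(2) show "r = m" by (intro min) (auto simp: A_def)
  qed
  with that m(2) show thesis by (auto simp: le_fun_def)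
qed

text \<open>If \<^term>\<open>C\<close> has distance at least \<^term>\<open>d\<close> from \<^term>\<open>z\<close>, then the cone generated by the pairs
\<^term>\<open>(c - z, d)\<close> is dominated by the norm. Lowering the norm along this cone and taking a linear
functional below the result gives the separating functional; being below the norm, it is bounded.\<close>
lemma separate_point_closed_convex:
  fixes C :: "'a::real_normed_vector set"
  assumes "closed C" and "convex C" and "C \<noteq> {}" and "z \<notin> C"
  obtains f :: "'a \<Rightarrow> real" and d where "bounded_linear f" and "0 < d" and "\<And>c. c \<in> C \<Longrightarrow> f z + d \<le> f c"
proof -
  have "open (- C)" and "z \<in> - C"
    using \<open>closed C\<close> \<open>z \<notin> C\<close> by (simp_all add: open_Compl)
  then obtain d where d: "0 < d" and "ball z d \<subseteq> - C"
    by (meson open_contains_ball)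
  then have dist: "d \<le> dist z c" if "c \<in> C" for c
    using that by (meson ComplD linorder_not_le mem_ball subsetD)
  let ?K = "{(t *\<^sub>R (c - z), t * d) |t c. 0 \<le> t \<and> c \<in> C}"
  obtain p where p: "sublinear p" "\<And>x. p x \<le> norm x"
    and pK: "\<And>x k s. (k, s) \<in> ?K \<Longrightarrow> p x \<le> norm (x + k) - s"
  proof (rule sublinear_minorant[OF sublinear_norm, of ?K])
    show "(0, 0) \<in> ?K"
    proof -
      from \<open>C \<noteq> {}\<close> obtain c where "c \<in> C" by blast
      then show ?thesis by (intro CollectI exI[of _ 0] exI[of _ c]) simp
    qed
    fix k l s t assume "(k, s) \<in> ?K" "(l, t) \<in> ?K"
    then obtain a b c e where *: "0 \<le> a" "c \<in> C" "k = a *\<^sub>R (c - z)" "s = a * d"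
      "0 \<le> b" "e \<in> C" "l = b *\<^sub>R (e - z)" "t = b * d"
      by blast
    show "(k + l, s + t) \<in> ?K"
    proof (cases "a + b = 0")
      case True
      with * have "a = 0" "b = 0" by auto
      with * show ?thesis by (intro CollectI exI[of _ 0] exI[of _ c]) simp
    next
      case False
      let ?m = "(a / (a + b)) *\<^sub>R c + (b / (a + b)) *\<^sub>R e"
      have "?m \<in> C"
        using * False by (intro convexD[OF \<open>convex C\<close>]) (simp_all add: add_divide_distrib[symmetric])
      moreover have "k + l = (a + b) *\<^sub>R (?m - z)"
      proof -
        have "(a + b) *\<^sub>R (?m - z) = (a + b) *\<^sub>R ?m - (a + b) *\<^sub>R z"
          by (rule scaleR_diff_right)
        also have "(a + b) *\<^sub>R ?m = a *\<^sub>R c + b *\<^sub>R e"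
          using False by (simp add: scaleR_add_right)
        finally show ?thesis
          using * by (simp add: scaleR_add_left scaleR_diff_right)
      qed
      moreover have "s + t = (a + b) * d" "0 \<le> a + b"
        using * by (simp_all add: algebra_simps)
      ultimately show ?thesis by blast
    qed
  next
    fix c k s assume "0 \<le> (c::real)" "(k, s) \<in> ?K"
    then obtain a e where "0 \<le> a" "e \<in> C" "k = a *\<^sub>R (e - z)" "s = a * d" by blast
    then have "c *\<^sub>R k = (c * a) *\<^sub>R (e - z) \<and> c * s = (c * a) * d \<and> 0 \<le> c * a \<and> e \<in> C"
      using \<open>0 \<le> c\<close> by simp
    then show "(c *\<^sub>R k, c * s) \<in> ?K" by blast
  next
    fix k s assume "(k, s) \<in> ?K"
    then obtain a c where "0 \<le> a" "c \<in> C" "k = a *\<^sub>R (c - z)" "s = a * d" by blast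
    then show "s \<le> norm k"
      using dist[of c] by (simp add: dist_norm norm_minus_commute mult_left_mono)
  qed blast
  obtain f where f: "linear f" "\<And>x. f x \<le> p x"
    using linear_below_sublinear[OF p(1)] by blast
  have fn: "f x \<le> norm x" for x
    using f(2) p(2) order_trans by blast
  have "\<bar>f x\<bar> \<le> norm x" for x
    using fn[of x] fn[of "- x"] by (simp add: linear_neg[OF f(1)] abs_le_iff)
  then have "bounded_linear f"
    by (intro bounded_linear_intro[of f 1]) (auto simp: linear_add[OF f(1)] linear_scale[OF f(1)])
  moreover have "f z + d \<le> f c" if "c \<in> C" for c
  proof -
    have "(c - z, d) \<in> ?K"
      using that by (intro CollectI exI[of _ 1] exI[of _ c]) simp
    from pK[OF this, of "- (c - z)"] f(2)[of "- (c - z)"] have "f (- (c - z)) \<le> - d"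
      by simp
    then show ?thesis
      by (simp add: linear_diff[OF f(1)])
  qed
  ultimately show thesis
    using that d by blast
qed

section \<open>Weak convergence\<close>
lemma weakly_converges_subseq:
  "weakly_converges x l \<Longrightarrow> strict_mono r \<Longrightarrow> weakly_converges (\<lambda>n. x (r n)) l"
  unfolding weakly_converges_def using filterlim_compose[OF _ filterlim_subseq] by fast

lemma weakly_converges_add:
  assumes "weakly_converges x l" and "weakly_converges y m"
  shows "weakly_converges (\<lambda>n. x n + y n) (l + m)"
  using assms unfolding weakly_converges_def
  by (auto simp: linear_add bounded_linear.linear intro!: tendsto_add)

lemma weakly_converges_scaleR:
  assumes "c \<longlonglongrightarrow> d" and "weakly_converges x l"
  shows "weakly_converges (\<lambda>n. c n *\<^sub>R x n) (d *\<^sub>R l)"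
  using assms unfolding weakly_converges_def
  by (auto simp: linear_scale bounded_linear.linear intro!: tendsto_mult)

lemma weakly_converges_minus:
  "weakly_converges x l \<Longrightarrow> weakly_converges (\<lambda>n. - x n) (- l)"
  using weakly_converges_scaleR[OF tendsto_const, of x l "- 1"] by simp

lemma tendsto_weakly_converges: "x \<longlonglongrightarrow> l \<Longrightarrow> weakly_converges x l"
  by (simp add: weakly_converges_def bounded_linear.tendsto)

lemma weakly_converges_cong:
  assumes "weakly_converges x l" and "eventually (\<lambda>n. x n = y n) sequentially"
  shows "weakly_converges y l"
  unfolding weakly_converges_def
proof (intro allI impI)
  fix f :: "'a \<Rightarrow> real" assume "bounded_linear f"
  with assms(1) have "(\<lambda>n. f (x n)) \<longlonglongrightarrow> f l"
    by (simp add: weakly_converges_def)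
  moreover have "eventually (\<lambda>n. f (x n) = f (y n)) sequentially"
    using assms(2) by eventually_elim simp
  ultimately show "(\<lambda>n. f (y n)) \<longlonglongrightarrow> f l"
    by (rule Lim_transform_eventually)
qed

text \<open>Mazur's theorem for sequences: a functional that separates the limit from \<^term>\<open>C\<close> would have its
values along the sequence bounded away from its value at the limit.\<close>
lemma weakly_converges_mem:
  assumes "closed C" and "convex C" and x: "weakly_converges x l"
    and mem: "eventually (\<lambda>n. x n \<in> C) sequentially"
  shows "l \<in> C"
proof (rule ccontr)
  assume "l \<notin> C"
  moreover have "C \<noteq> {}"
    using eventually_happens'[OF sequentially_bot mem] by blast
  ultimately obtain f :: "'a \<Rightarrow> real" and d where f: "bounded_linear f" and d: "0 < d"
    and sep: "\<And>c. c \<in> C \<Longrightarrow> f l + d \<le> f c"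
    using separate_point_closed_convex[OF assms(1,2)] by metis
  from x f have "(\<lambda>n. f (x n)) \<longlonglongrightarrow> f l"
    by (simp add: weakly_converges_def)
  then have "f l + d \<le> f l"
    by (rule tendsto_lowerbound) (use mem sep in \<open>auto elim: eventually_mono\<close>)
  with d show False by simp
qed

lemma weakly_converges_unique:
  assumes l: "weakly_converges x l" and m: "weakly_converges x m"
  shows "l = m"
proof -
  \<comment> \<open>The null sequence lies in the closed convex set \<^term>\<open>{0}\<close>, and so does its weak limit.\<close>
  have "weakly_converges (\<lambda>n. x n + - x n) (l + - m)"
    by (intro weakly_converges_add weakly_converges_minus l m)
  then have "l + - m \<in> {0}"
    by (rule weakly_converges_mem[rotated 2]) auto
  then show ?thesis by simp
qed

text \<open>The convex combinations of \<^term>\<open>a\<close> and \<^term>\<open>c n\<close> with weight \<^term>\<open>t * \<rho> n\<close> on the latter lie in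
\<^term>\<open>C\<close> once \<^term>\<open>t * \<rho> n < 1\<close>, and they tend weakly to \<^term>\<open>a + t *\<^sub>R u\<close> because the weights vanish.\<close>
lemma weak_limit_in_recession_cone:
  assumes "closed C" and "convex C" and c: "\<And>n. c n \<in> C"
    and nonneg: "\<And>n. 0 \<le> \<rho> n" and null: "\<rho> \<longlonglongrightarrow> 0"
    and lim: "weakly_converges (\<lambda>n. \<rho> n *\<^sub>R c n) u"
  shows "u \<in> recession_cone C"
  unfolding recession_cone_def
proof (intro CollectI ballI allI impI)
  fix a and t :: real assume a: "a \<in> C" and t: "0 \<le> t"
  let ?y = "\<lambda>n. (1 - t * \<rho> n) *\<^sub>R a + (t * \<rho> n) *\<^sub>R c n"
  have to_0: "(\<lambda>n. t * \<rho> n) \<longlonglongrightarrow> 0"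
    using tendsto_mult_left[OF null, of t] by simp
  then have "eventually (\<lambda>n. t * \<rho> n < 1) sequentially"
    by (rule order_tendstoD) simp
  then have mem: "eventually (\<lambda>n. ?y n \<in> C) sequentially"
    by eventually_elim (use a t c nonneg in \<open>auto intro: convexD_alt[OF \<open>convex C\<close>]\<close>)
  have "(\<lambda>n. (1 - t * \<rho> n) *\<^sub>R a) \<longlonglongrightarrow> (1 - 0) *\<^sub>R a"
    by (intro tendsto_intros to_0)
  then have "weakly_converges (\<lambda>n. (1 - t * \<rho> n) *\<^sub>R a + t *\<^sub>R (\<rho> n *\<^sub>R c n)) ((1 - 0) *\<^sub>R a + t *\<^sub>R u)"
    by (intro weakly_converges_add tendsto_weakly_converges weakly_converges_scaleR tendsto_const lim)
  then have "weakly_converges ?y (a + t *\<^sub>R u)"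
    by simp
  then show "a + t *\<^sub>R u \<in> C"
    using mem by (rule weakly_converges_mem[OF assms(1,2)])
qed

lemma bounded_real_convergent_subseq:
  fixes f :: "nat \<Rightarrow> real"
  assumes "eventually (\<lambda>n. \<bar>f n\<bar> \<le> K) sequentially"
  obtains r l where "strict_mono r" and "(\<lambda>n. f (r n)) \<longlonglongrightarrow> l"
proof -
  have "Bseq f"
    using assms by (intro BfunI[of _ K]) simp
  then have "bounded (range f)"
    by (simp add: Bseq_eq_bounded)
  then show thesis
    using bounded_imp_convergent_subsequence[of f] that by (auto simp: o_def)
qed

lemma bounded_div_at_top_tendsto_0:
  fixes e :: "nat \<Rightarrow> 'a::real_normed_vector"
  assumes s: "filterlim s at_top sequentially" and e: "\<And>n. norm (e n) \<le> M"
  shows "(\<lambda>n. e n /\<^sub>R s n) \<longlonglongrightarrow> 0"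
proof (rule Lim_null_comparison)
  show "(\<lambda>n. M * \<bar>inverse (s n)\<bar>) \<longlonglongrightarrow> 0"
    using tendsto_mult_left[OF tendsto_rabs[OF tendsto_inverse_0_at_top[OF s]], of M] by simp
  show "eventually (\<lambda>n. norm (e n /\<^sub>R s n) \<le> M * \<bar>inverse (s n)\<bar>) sequentially"
    using e by (auto simp: mult.commute[of M] intro!: always_eventually mult_left_mono)
qed

section \<open>Asymptotic directions in weakly narrow sets\<close>
lemma weakly_narrowE:
  assumes "weakly_narrow A" and "\<And>n. x n \<in> A" and "filterlim (\<lambda>n. norm (x n)) at_top sequentially"
  obtains r l where "strict_mono r" and "l \<noteq> 0"
    and "weakly_converges (\<lambda>n. x (r n) /\<^sub>R norm (x (r n))) l"
proof -
  have "range x \<subseteq> A"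
    using assms(2) by blast
  with assms(1,3) show thesis
    unfolding weakly_narrow_def using that by blast
qed

text \<open>Weak narrowness with an arbitrary scale \<^term>\<open>s\<close> in place of the norm. This form applies to two
sequences at once, normalised by a common factor. If the quotients of norm and scale tend to a positive
number, then the norms tend to infinity and the definition applies; otherwise the scaled points tend to
zero in norm. The condition that a zero limit \<^term>\<open>l\<close> forces \<^term>\<open>\<theta> = 0\<close> is what remains of the
requirement that the weak limit of normalised points is not the origin.\<close>
lemma narrow_scaled_limit:
  assumes A: "closed A" "convex A" "weakly_narrow A"
    and x: "\<And>n. x n \<in> A" "\<And>n. norm (x n) \<le> s n"
    and s: "filterlim s at_top sequentially"
  obtains r l \<theta> where "strict_mono r" and "weakly_converges (\<lambda>n. x (r n) /\<^sub>R s (r n)) l"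
    and "(\<lambda>n. norm (x (r n)) / s (r n)) \<longlonglongrightarrow> \<theta>" and "l = 0 \<Longrightarrow> \<theta> = 0"
    and "l \<in> recession_cone A"
proof -
  have s0: "0 \<le> s n" for n
    using x(2)[of n] norm_ge_zero[of "x n"] by linarith
  have "\<bar>norm (x n) / s n\<bar> \<le> 1" for n
    using x(2)[of n] s0[of n] by (cases "s n = 0") (auto simp: field_simps)
  then obtain r \<theta> where r: "strict_mono r" and \<theta>: "(\<lambda>n. norm (x (r n)) / s (r n)) \<longlonglongrightarrow> \<theta>"
    using bounded_real_convergent_subseq[of "\<lambda>n. norm (x n) / s n" 1] by auto
  have sr: "filterlim (\<lambda>n. s (r n)) at_top sequentially"
    using filterlim_compose[OF s filterlim_subseq[OF r]] .
  have "\<exists>p l. strict_mono p \<and> weakly_converges (\<lambda>n. x (r (p n)) /\<^sub>R s (r (p n))) l \<and> (l = 0 \<longrightarrow> \<theta> = 0)"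
  proof (cases "\<theta> = 0")
    case True
    have "norm (x (r n) /\<^sub>R s (r n)) = norm (x (r n)) / s (r n)" for n
      using s0[of "r n"] by (simp add: divide_inverse_commute)
    with \<theta> True have "(\<lambda>n. norm (x (r n) /\<^sub>R s (r n))) \<longlonglongrightarrow> 0"
      by simp
    then have "(\<lambda>n. x (r n) /\<^sub>R s (r n)) \<longlonglongrightarrow> 0"
      by (rule tendsto_norm_zero_cancel)
    then have "weakly_converges (\<lambda>n. x (r (id n)) /\<^sub>R s (r (id n))) 0"
      by (simp add: tendsto_weakly_converges)
    with True show ?thesis
      using strict_mono_id by blast
  next
    case False
    have "0 \<le> \<theta>"
      using s0 by (intro LIMSEQ_le_const[OF \<theta>]) auto
    with False have "0 < \<theta>" by simp
    have "filterlim (\<lambda>n. norm (x (r n)) / s (r n) * s (r n)) at_top sequentially"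
      by (rule filterlim_tendsto_pos_mult_at_top[OF \<theta> \<open>0 < \<theta>\<close> sr])
    moreover have "norm (x (r n)) / s (r n) * s (r n) \<le> norm (x (r n))" for n
      by (cases "s (r n) = 0") auto
    ultimately have "filterlim (\<lambda>n. norm (x (r n))) at_top sequentially"
      by (auto intro: filterlim_at_top_mono always_eventually)
    then obtain p l where p: "strict_mono p" and "l \<noteq> 0"
      and l: "weakly_converges (\<lambda>n. x (r (p n)) /\<^sub>R norm (x (r (p n)))) l"
      using weakly_narrowE[OF A(3), of "\<lambda>n. x (r n)"] x(1) by blast
    have "(\<lambda>n. norm (x (r (p n))) / s (r (p n))) \<longlonglongrightarrow> \<theta>"
      using filterlim_compose[OF \<theta> filterlim_subseq[OF p]] .
    from weakly_converges_scaleR[OF this l]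
    have "weakly_converges (\<lambda>n. x (r (p n)) /\<^sub>R s (r (p n))) (\<theta> *\<^sub>R l)"
      by (rule weakly_converges_cong) (auto simp: divide_inverse intro!: always_eventually)
    moreover have "\<theta> *\<^sub>R l \<noteq> 0"
      using \<open>l \<noteq> 0\<close> False by simp
    ultimately show ?thesis
      using p by blast
  qed
  then obtain p l where p: "strict_mono p" and l: "weakly_converges (\<lambda>n. x (r (p n)) /\<^sub>R s (r (p n))) l"
    and l0: "l = 0 \<Longrightarrow> \<theta> = 0"
    by blast
  have "l \<in> recession_cone A"
  proof (rule weak_limit_in_recession_cone[OF A(1,2) _ _ _ l])
    show "(\<lambda>n. inverse (s (r (p n)))) \<longlonglongrightarrow> 0"
      by (rule tendsto_inverse_0_at_top[OF filterlim_compose[OF sr filterlim_subseq[OF p]]])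
    show "x (r (p n)) \<in> A" "0 \<le> inverse (s (r (p n)))" for n
      using x(1) s0 by simp_all
  qed
  moreover have "strict_mono (\<lambda>n. r (p n))"
    using strict_mono_o[OF r p] by (simp add: o_def)
  moreover have "(\<lambda>n. norm (x (r (p n))) / s (r (p n))) \<longlonglongrightarrow> \<theta>"
    using filterlim_compose[OF \<theta> filterlim_subseq[OF p]] .
  ultimately show thesis
    using that[of "\<lambda>n. r (p n)"] l l0 by blast
qed

text \<open>The converse passage, from a scale back to the norm, and stable under bounded perturbation: along a
subsequence the quotient of norm and scale converges, and its limit is not zero because the scaled points
would then tend to zero, contrary to \<^term>\<open>l \<noteq> 0\<close>.\<close>
lemma normalised_subsequence:
  assumes s: "filterlim s at_top sequentially"
    and y: "weakly_converges (\<lambda>n. y n /\<^sub>R s n) l" "l \<noteq> 0" "\<And>n. norm (y n) \<le> s n"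
    and xy: "\<And>n. norm (x n - y n) \<le> M"
  obtains r m where "strict_mono r" and "m \<noteq> 0"
    and "weakly_converges (\<lambda>n. x (r n) /\<^sub>R norm (x (r n))) m"
proof -
  have "weakly_converges (\<lambda>n. y n /\<^sub>R s n + (x n - y n) /\<^sub>R s n) (l + 0)"
    by (intro weakly_converges_add y(1) tendsto_weakly_converges bounded_div_at_top_tendsto_0[OF s xy])
  then have x: "weakly_converges (\<lambda>n. x n /\<^sub>R s n) l"
    by (simp add: scaleR_diff_right)
  have pos: "eventually (\<lambda>n. 0 < s n) sequentially" and large: "eventually (\<lambda>n. M \<le> s n) sequentially"
    using filterlim_at_top_dense[THEN iffD1, OF s] filterlim_at_top[THEN iffD1, OF s] by blast+
  have "eventually (\<lambda>n. \<bar>norm (x n) / s n\<bar> \<le> 2) sequentially"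
    using pos large
  proof eventually_elim
    case (elim n)
    have "norm (x n) \<le> norm (y n) + norm (x n - y n)"
      by (metis add.commute diff_add_cancel norm_triangle_ineq)
    with elim y(3)[of n] xy[of n] show ?case
      by (simp add: field_simps)
  qed
  then obtain r \<gamma> where r: "strict_mono r" and \<gamma>: "(\<lambda>n. norm (x (r n)) / s (r n)) \<longlonglongrightarrow> \<gamma>"
    by (rule bounded_real_convergent_subseq)
  have xr: "weakly_converges (\<lambda>n. x (r n) /\<^sub>R s (r n)) l"
    using weakly_converges_subseq[OF x r] .
  have pos_r: "eventually (\<lambda>n. 0 < s (r n)) sequentially"
    by (rule eventually_subseq[OF r pos])
  have "\<gamma> \<noteq> 0"
  proof
    assume "\<gamma> = 0"
    have "eventually (\<lambda>n. norm (x (r n)) / s (r n) = norm (x (r n) /\<^sub>R s (r n))) sequentially"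
      using pos_r by eventually_elim (simp add: divide_inverse_commute)
    with \<gamma> have "(\<lambda>n. norm (x (r n) /\<^sub>R s (r n))) \<longlonglongrightarrow> 0"
      unfolding \<open>\<gamma> = 0\<close> by (rule Lim_transform_eventually)
    then have "weakly_converges (\<lambda>n. x (r n) /\<^sub>R s (r n)) 0"
      by (rule tendsto_norm_zero_cancel[THEN tendsto_weakly_converges])
    with y(2) show False
      using weakly_converges_unique[OF xr] by blast
  qed
  then have "(\<lambda>n. inverse (norm (x (r n)) / s (r n))) \<longlonglongrightarrow> inverse \<gamma>"
    by (intro tendsto_inverse \<gamma>)
  note lim = weakly_converges_scaleR[OF this xr]
  have "eventually (\<lambda>n. inverse (norm (x (r n)) / s (r n)) *\<^sub>R (x (r n) /\<^sub>R s (r n))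
    = x (r n) /\<^sub>R norm (x (r n))) sequentially"
    using pos_r by eventually_elim (simp add: inverse_eq_divide)
  with lim have wc: "weakly_converges (\<lambda>n. x (r n) /\<^sub>R norm (x (r n))) (inverse \<gamma> *\<^sub>R l)"
    by (rule weakly_converges_cong)
  have "inverse \<gamma> *\<^sub>R l \<noteq> 0"
    using \<open>\<gamma> \<noteq> 0\<close> y(2) by simp
  then show thesis
    using wc by (rule that[OF r])
qed

section \<open>Recession cones and closed sums\<close>
lemma recession_coneD: "v \<in> recession_cone A \<Longrightarrow> a \<in> A \<Longrightarrow> 0 \<le> t \<Longrightarrow> a + t *\<^sub>R v \<in> A"
  by (simp add: recession_cone_def)

lemma zero_in_recession_cone: "0 \<in> recession_cone A"
  by (simp add: recession_cone_def)

lemma pointedD: "pointed V \<Longrightarrow> v \<in> V \<Longrightarrow> - v \<in> V \<Longrightarrow> v = 0"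
  unfolding pointed_def by (metis IntI add.inverse_inverse imageI singletonD)

text \<open>A translate of the recession cone lies in \<^term>\<open>A\<close>, and translation by \<^term>\<open>a\<close> is a bounded perturbation.\<close>
lemma weakly_narrow_recession_cone:
  assumes A: "weakly_narrow A" and a: "a \<in> A"
  shows "weakly_narrow (recession_cone A)"
  unfolding weakly_narrow_def
proof (intro allI impI)
  fix x :: "nat \<Rightarrow> 'a"
  assume "range x \<subseteq> recession_cone A \<and> filterlim (\<lambda>n. norm (x n)) at_top sequentially"
  then have x: "x n \<in> recession_cone A" and lim: "filterlim (\<lambda>n. norm (x n)) at_top sequentially" for n
    by auto
  have mem: "a + x n \<in> A" for n
    using recession_coneD[OF x[of n] a, of 1] by simp
  have "filterlim (\<lambda>n. - norm a + norm (x n)) at_top sequentially"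
    by (rule filterlim_tendsto_add_at_top[OF tendsto_const lim])
  moreover have "- norm a + norm (x n) \<le> norm (a + x n)" for n
    using norm_triangle_ineq4[of "a + x n" a] by simp
  ultimately have lim': "filterlim (\<lambda>n. norm (a + x n)) at_top sequentially"
    by (rule filterlim_at_top_mono[OF _ always_eventually[OF allI]])
  obtain r l where r: "strict_mono r" and l: "l \<noteq> 0"
    "weakly_converges (\<lambda>n. (a + x (r n)) /\<^sub>R norm (a + x (r n))) l"
    using weakly_narrowE[OF A, of "\<lambda>n. a + x n"] mem lim' by blast
  have "filterlim (\<lambda>n. norm (a + x (r n))) at_top sequentially"
    by (rule filterlim_compose[OF lim' filterlim_subseq[OF r]])
  then obtain p m where "strict_mono p" "m \<noteq> 0"
    "weakly_converges (\<lambda>n. x (r (p n)) /\<^sub>R norm (x (r (p n)))) m"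
    by (rule normalised_subsequence[where y = "\<lambda>n. a + x (r n)" and x = "\<lambda>n. x (r n)" and M = "norm a"])
      (use l in auto)
  moreover from \<open>strict_mono p\<close> r have "strict_mono (r \<circ> p)"
    by (simp add: strict_mono_o)
  ultimately show "\<exists>r l. strict_mono r \<and> l \<noteq> 0 \<and> weakly_converges (\<lambda>k. x (r k) /\<^sub>R norm (x (r k))) l"
    by (intro exI[of _ "r \<circ> p"] exI[of _ m]) (simp add: o_def)
qed

text \<open>No cancellation at infinity. The summands, divided by the sum of their norms, have weak limits \<open>v\<close> and
\<open>w\<close> in \<^term>\<open>V\<close>. The limits of the scaled norms add up to one, so \<open>v\<close> and \<open>w\<close> are not both zero, and
pointedness gives \<open>v + w \<noteq> 0\<close>.\<close>
lemma sum_scaled_limit: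
  assumes A: "closed A" "convex A" "weakly_narrow A" "recession_cone A = V"
    and B: "closed B" "convex B" "weakly_narrow B" "recession_cone B = V"
    and V: "convex V" "cone V" "pointed V"
    and a: "\<And>n. a n \<in> A" and b: "\<And>n. b n \<in> B"
    and s: "filterlim (\<lambda>n. norm (a n) + norm (b n)) at_top sequentially"
  obtains r z where "strict_mono r" and "z \<in> V" and "z \<noteq> 0"
    and "weakly_converges (\<lambda>n. (a (r n) + b (r n)) /\<^sub>R (norm (a (r n)) + norm (b (r n)))) z"
proof -
  let ?s = "\<lambda>n. norm (a n) + norm (b n)"
  obtain p v \<theta> where p: "strict_mono p" and v: "weakly_converges (\<lambda>n. a (p n) /\<^sub>R ?s (p n)) v"
    and \<theta>: "(\<lambda>n. norm (a (p n)) / ?s (p n)) \<longlonglongrightarrow> \<theta>" "v = 0 \<Longrightarrow> \<theta> = 0" and vV: "v \<in> V"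
    by (rule narrow_scaled_limit[OF A(1-3), unfolded A(4), where x = a, OF a _ s]) simp_all
  have sp: "filterlim (\<lambda>n. ?s (p n)) at_top sequentially"
    by (rule filterlim_compose[OF s filterlim_subseq[OF p]])
  obtain q w \<eta> where q: "strict_mono q" and w: "weakly_converges (\<lambda>n. b (p (q n)) /\<^sub>R ?s (p (q n))) w"
    and \<eta>: "(\<lambda>n. norm (b (p (q n))) / ?s (p (q n))) \<longlonglongrightarrow> \<eta>" "w = 0 \<Longrightarrow> \<eta> = 0" and wV: "w \<in> V"
    by (rule narrow_scaled_limit[OF B(1-3), unfolded B(4), where x = "\<lambda>n. b (p n)", OF b _ sp]) simp_all
  let ?r = "\<lambda>n. p (q n)"
  have r: "strict_mono ?r"
    using strict_mono_o[OF p q] by (simp add: o_def)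
  have sr: "filterlim (\<lambda>n. ?s (?r n)) at_top sequentially"
    by (rule filterlim_compose[OF s filterlim_subseq[OF r]])
  have "(\<lambda>n. norm (a (?r n)) / ?s (?r n)) \<longlonglongrightarrow> \<theta>"
    by (rule filterlim_compose[OF \<theta>(1) filterlim_subseq[OF q]])
  from tendsto_add[OF this \<eta>(1)]
  have "(\<lambda>n. norm (a (?r n)) / ?s (?r n) + norm (b (?r n)) / ?s (?r n)) \<longlonglongrightarrow> \<theta> + \<eta>" .
  moreover have "eventually (\<lambda>n. norm (a (?r n)) / ?s (?r n) + norm (b (?r n)) / ?s (?r n) = 1) sequentially"
    using filterlim_at_top_dense[THEN iffD1, OF sr, rule_format, of 0]
    by eventually_elim (simp add: add_divide_distrib[symmetric])
  ultimately have "(\<lambda>n. 1) \<longlonglongrightarrow> \<theta> + \<eta>"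
    by (rule Lim_transform_eventually)
  then have sum: "\<theta> + \<eta> = 1"
    by (simp add: LIMSEQ_const_iff)
  have "v + w \<noteq> 0"
  proof
    assume "v + w = 0"
    then have "w = - v" by (simp add: add_eq_0_iff)
    with pointedD[OF V(3) vV] wV have "v = 0" "w = 0" by auto
    with \<theta>(2) \<eta>(2) sum show False by simp
  qed
  moreover have "v + w \<in> V"
    using V(1,2) vV wV convex_cone by blast
  moreover have "weakly_converges (\<lambda>n. (a (?r n) + b (?r n)) /\<^sub>R ?s (?r n)) (v + w)"
    using weakly_converges_add[OF weakly_converges_subseq[OF v q] w] by (simp add: scaleR_add_right)
  ultimately show thesis
    using that[OF r] by simp
qed

text \<open>Points of the closure are replaced by honest sums at bounded distance, which does not affect limits
after division by a scale that tends to infinity.\<close>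
lemma closure_sum_approx:
  fixes A B :: "'a::real_normed_vector set"
  assumes "\<And>n::nat. z n \<in> closure (A + B)"
  obtains a b where "\<And>n. a n \<in> A" and "\<And>n. b n \<in> B" and "\<And>n. norm (z n - (a n + b n)) \<le> 1"
proof -
  have "\<exists>a b. a \<in> A \<and> b \<in> B \<and> norm (z n - (a + b)) \<le> 1" for n
  proof -
    obtain y where "y \<in> A + B" and y: "dist y (z n) < 1"
      using assms[of n] unfolding closure_approachable by (meson zero_less_one)
    then obtain a b where "a \<in> A" "b \<in> B" "y = a + b"
      by (meson set_plus_elim)
    moreover from this y have "norm (z n - (a + b)) \<le> 1"
      by (simp add: dist_norm norm_minus_commute)
    ultimately show ?thesis by blast
  qed
  then show thesis
    using that by metis
qed

lemma norm_sum_at_top: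
  fixes z :: "nat \<Rightarrow> 'a::real_normed_vector"
  assumes z: "filterlim (\<lambda>n. norm (z n)) at_top sequentially"
    and le: "\<And>n. norm (z n - (a n + b n)) \<le> M"
  shows "filterlim (\<lambda>n. norm (a n) + norm (b n)) at_top sequentially"
proof (rule filterlim_at_top_mono[OF _ always_eventually[OF allI]])
  show "filterlim (\<lambda>n. - M + norm (z n)) at_top sequentially"
    by (rule filterlim_tendsto_add_at_top[OF tendsto_const z])
  show "- M + norm (z n) \<le> norm (a n) + norm (b n)" for n
    using le[of n] norm_triangle_ineq2[of "z n" "a n + b n"] norm_triangle_ineq[of "a n" "b n"] by linarith
qed

lemma weakly_narrow_closed_sum:
  assumes A: "closed A" "convex A" "weakly_narrow A" "recession_cone A = V"
    and B: "closed B" "convex B" "weakly_narrow B" "recession_cone B = V"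
    and V: "convex V" "cone V" "pointed V"
  shows "weakly_narrow (closed_sum A B)"
  unfolding weakly_narrow_def closed_sum_def
proof (intro allI impI)
  fix x :: "nat \<Rightarrow> 'a"
  assume *: "range x \<subseteq> closure (A + B) \<and> filterlim (\<lambda>n. norm (x n)) at_top sequentially"
  then have mem: "x n \<in> closure (A + B)" for n
    by auto
  obtain a b where a: "\<And>n. a n \<in> A" and b: "\<And>n. b n \<in> B" and ab: "\<And>n. norm (x n - (a n + b n)) \<le> 1"
    by (rule closure_sum_approx[of x, OF mem]) blast
  have s: "filterlim (\<lambda>n. norm (a n) + norm (b n)) at_top sequentially"
    using norm_sum_at_top[OF conjunct2[OF *] ab] .
  obtain r z where r: "strict_mono r" and "z \<noteq> 0"
    and z: "weakly_converges (\<lambda>n. (a (r n) + b (r n)) /\<^sub>R (norm (a (r n)) + norm (b (r n)))) z"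
    by (rule sum_scaled_limit[OF A B V a b s])
  have sr: "filterlim (\<lambda>n. norm (a (r n)) + norm (b (r n))) at_top sequentially"
    by (rule filterlim_compose[OF s filterlim_subseq[OF r]])
  obtain p m where "strict_mono p" "m \<noteq> 0"
    "weakly_converges (\<lambda>n. x (r (p n)) /\<^sub>R norm (x (r (p n)))) m"
    by (rule normalised_subsequence[OF sr z \<open>z \<noteq> 0\<close> norm_triangle_ineq, of "\<lambda>n. x (r n)" 1])
      (use ab in auto)
  moreover from \<open>strict_mono p\<close> r have "strict_mono (r \<circ> p)"
    by (simp add: strict_mono_o)
  ultimately show "\<exists>r l. strict_mono r \<and> l \<noteq> 0 \<and> weakly_converges (\<lambda>k. x (r k) /\<^sub>R norm (x (r k))) l"
    by (intro exI[of _ "r \<circ> p"] exI[of _ m]) (simp add: o_def)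
qed

text \<open>Following a ray of direction \<^term>\<open>u\<close> inside the closed sum and decomposing its points into summands,
the scaled sums tend weakly to some nonzero \<open>z\<close> in \<^term>\<open>V\<close>. They are also asymptotic to nonnegative
multiples of \<^term>\<open>u\<close>, so \<open>z = \<gamma> u\<close> with \<open>\<gamma> > 0\<close>, and \<^term>\<open>u\<close> lies in \<^term>\<open>V\<close>.\<close>
lemma recession_cone_closed_sum_subset:
  assumes A: "closed A" "convex A" "weakly_narrow A" "recession_cone A = V" "A \<noteq> {}"
    and B: "closed B" "convex B" "weakly_narrow B" "recession_cone B = V" "B \<noteq> {}"
    and V: "convex V" "cone V" "pointed V"
  shows "recession_cone (closed_sum A B) \<subseteq> V"
proof
  fix u assume u: "u \<in> recession_cone (closed_sum A B)"
  show "u \<in> V"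
  proof (cases "u = 0")
    case True
    with zero_in_recession_cone[of A] A(4) show ?thesis by simp
  next
    case False
    from A(5) B(5) obtain a0 b0 where "a0 \<in> A" "b0 \<in> B" by blast
    then have ab0: "a0 + b0 \<in> closed_sum A B"
      unfolding closed_sum_def by (intro closure_subset[THEN subsetD] set_plus_intro)
    define x where "x n = (a0 + b0) + real n *\<^sub>R u" for n
    have mem: "x n \<in> closure (A + B)" for n
      using recession_coneD[OF u ab0, of "real n"] by (simp add: closed_sum_def x_def)
    obtain a b where a: "\<And>n. a n \<in> A" and b: "\<And>n. b n \<in> B" and ab: "\<And>n. norm (x n - (a n + b n)) \<le> 1"
      by (rule closure_sum_approx[of x, OF mem]) blast
    let ?s = "\<lambda>n. norm (a n) + norm (b n)"
    have err: "norm (real n *\<^sub>R u - (a n + b n)) \<le> 1 + norm (a0 + b0)" for n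
      using ab[of n] norm_triangle_ineq4[of "x n - (a n + b n)" "a0 + b0"]
      by (simp add: x_def algebra_simps)
    have "filterlim (\<lambda>n. norm (real n *\<^sub>R u)) at_top sequentially"
      using False filterlim_tendsto_pos_mult_at_top[OF tendsto_const _ filterlim_real_sequentially, of "norm u"]
      by (simp add: mult.commute)
    then have s: "filterlim ?s at_top sequentially"
      using err by (rule norm_sum_at_top)
    obtain r z where r: "strict_mono r" and zV: "z \<in> V" and "z \<noteq> 0"
      and z: "weakly_converges (\<lambda>n. (a (r n) + b (r n)) /\<^sub>R ?s (r n)) z"
      by (rule sum_scaled_limit[OF A(1-4) B(1-4) V a b s])
    have sr: "filterlim (\<lambda>n. ?s (r n)) at_top sequentially"
      by (rule filterlim_compose[OF s filterlim_subseq[OF r]])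
    have "(\<lambda>n. (real (r n) *\<^sub>R u - (a (r n) + b (r n))) /\<^sub>R ?s (r n)) \<longlonglongrightarrow> 0"
      using err by (intro bounded_div_at_top_tendsto_0[OF sr])
    from weakly_converges_add[OF z tendsto_weakly_converges[OF this]]
    have zu: "weakly_converges (\<lambda>n. (real (r n) / ?s (r n)) *\<^sub>R u) z"
      by (simp add: scaleR_add_right[symmetric] divide_inverse_commute)
    have large: "eventually (\<lambda>n. 1 + norm (a0 + b0) < ?s (r n)) sequentially"
      using filterlim_at_top_dense[THEN iffD1, OF sr] by blast
    have "eventually (\<lambda>n. \<bar>real (r n) / ?s (r n)\<bar> \<le> 2 / norm u) sequentially"
      using large
    proof eventually_elim
      case (elim n)
      have "norm (real (r n) *\<^sub>R u) \<le> norm (real (r n) *\<^sub>R u - (a (r n) + b (r n))) + norm (a (r n) + b (r n))"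
        by (metis diff_add_cancel norm_triangle_ineq)
      also have "\<dots> \<le> ?s (r n) + ?s (r n)"
        by (intro add_mono order_trans[OF err less_imp_le[OF elim]] norm_triangle_ineq)
      finally have "real (r n) * norm u \<le> 2 * ?s (r n)"
        by simp
      moreover have "0 < ?s (r n)"
        using elim norm_ge_zero[of "a0 + b0"] by linarith
      ultimately show ?case
        using False by (simp add: field_simps)
    qed
    then obtain p \<gamma> where p: "strict_mono p" and \<gamma>: "(\<lambda>n. real (r (p n)) / ?s (r (p n))) \<longlonglongrightarrow> \<gamma>"
      by (rule bounded_real_convergent_subseq)
    have "(\<lambda>n. (real (r (p n)) / ?s (r (p n))) *\<^sub>R u) \<longlonglongrightarrow> \<gamma> *\<^sub>R u"
      by (intro tendsto_intros \<gamma>)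
    then have "z = \<gamma> *\<^sub>R u"
      using weakly_converges_unique[OF weakly_converges_subseq[OF zu p]] tendsto_weakly_converges by blast
    moreover have "0 \<le> \<gamma>"
      by (rule LIMSEQ_le_const[OF \<gamma>]) auto
    ultimately have "u = inverse \<gamma> *\<^sub>R z" "0 \<le> inverse \<gamma>"
      using \<open>z \<noteq> 0\<close> by auto
    with zV V(2) show ?thesis
      by (simp add: cone_def)
  qed
qed

lemma recession_cone_closed_sum_superset:
  "recession_cone A \<subseteq> recession_cone (closed_sum A B)"
proof
  fix v assume v: "v \<in> recession_cone A"
  show "v \<in> recession_cone (closed_sum A B)"
    unfolding recession_cone_def closed_sum_def
  proof (intro CollectI ballI allI impI)
    fix x and t :: real assume x: "x \<in> closure (A + B)" and t: "0 \<le> t"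
    show "x + t *\<^sub>R v \<in> closure (A + B)"
      unfolding closure_approachable
    proof (intro allI impI)
      fix e :: real assume "0 < e"
      with x obtain y where "y \<in> A + B" and y: "dist y x < e"
        unfolding closure_approachable by meson
      then obtain a b where "a \<in> A" "b \<in> B" "y = a + b"
        by (meson set_plus_elim)
      then have "(a + t *\<^sub>R v) + b \<in> A + B"
        by (intro set_plus_intro recession_coneD[OF v _ t])
      moreover have "dist ((a + t *\<^sub>R v) + b) (x + t *\<^sub>R v) < e"
        using y \<open>y = a + b\<close> by (simp add: dist_norm algebra_simps)
      ultimately show "\<exists>y\<in>A + B. dist y (x + t *\<^sub>R v) < e"
        by (rule bexI[rotated])
    qed
  qed
qed

lemma recession_cone_of_convex_cone:
  assumes "convex V" and "cone V" and "0 \<in> V"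
  shows "recession_cone V = V"
proof
  show "recession_cone V \<subseteq> V"
    using recession_coneD[OF _ \<open>0 \<in> V\<close>, of _ 1] by auto
  show "V \<subseteq> recession_cone V"
    using assms(1,2) convex_cone[of V] by (auto simp: recession_cone_def)
qed

lemma recession_cone_scaled:
  assumes "0 < c"
  shows "recession_cone ((\<lambda>a. c *\<^sub>R a) ` A) = recession_cone A"
proof (intro equalityI subsetI)
  fix v assume v: "v \<in> recession_cone A"
  show "v \<in> recession_cone ((\<lambda>a. c *\<^sub>R a) ` A)"
    unfolding recession_cone_def
  proof (intro CollectI ballI allI impI)
    fix x and t :: real assume "x \<in> (\<lambda>a. c *\<^sub>R a) ` A" and t: "0 \<le> t"
    then obtain a where a: "a \<in> A" "x = c *\<^sub>R a" by blast
    have "a + (t / c) *\<^sub>R v \<in> A"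
      using v a t assms by (intro recession_coneD) auto
    moreover have "x + t *\<^sub>R v = c *\<^sub>R (a + (t / c) *\<^sub>R v)"
      using a assms by (simp add: scaleR_add_right)
    ultimately show "x + t *\<^sub>R v \<in> (\<lambda>a. c *\<^sub>R a) ` A" by blast
  qed
next
  fix v assume v: "v \<in> recession_cone ((\<lambda>a. c *\<^sub>R a) ` A)"
  show "v \<in> recession_cone A"
    unfolding recession_cone_def
  proof (intro CollectI ballI allI impI)
    fix a and t :: real assume a: "a \<in> A" and t: "0 \<le> t"
    have "c *\<^sub>R a + (c * t) *\<^sub>R v \<in> (\<lambda>a. c *\<^sub>R a) ` A"
      using v a t assms by (intro recession_coneD) auto
    then obtain a' where "a' \<in> A" "c *\<^sub>R (a + t *\<^sub>R v) = c *\<^sub>R a'"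
      by (auto simp: scaleR_add_right)
    with assms show "a + t *\<^sub>R v \<in> A" by simp
  qed
qed

lemma weakly_narrow_scaled:
  assumes A: "weakly_narrow A" and c: "0 < c"
  shows "weakly_narrow ((\<lambda>a. c *\<^sub>R a) ` A)"
  unfolding weakly_narrow_def
proof (intro allI impI)
  fix x :: "nat \<Rightarrow> 'a"
  assume *: "range x \<subseteq> (\<lambda>a. c *\<^sub>R a) ` A \<and> filterlim (\<lambda>n. norm (x n)) at_top sequentially"
  define y where "y n = x n /\<^sub>R c" for n
  have y: "y n \<in> A" for n
  proof -
    from * obtain a where "a \<in> A" "x n = c *\<^sub>R a" by blast
    with c show ?thesis by (simp add: y_def)
  qed
  have "filterlim (\<lambda>n. inverse c * norm (x n)) at_top sequentially"
    using * c by (intro filterlim_tendsto_pos_mult_at_top[OF tendsto_const]) auto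
  then have lim: "filterlim (\<lambda>n. norm (y n)) at_top sequentially"
    using c by (simp add: y_def)
  have eq: "y n /\<^sub>R norm (y n) = x n /\<^sub>R norm (x n)" for n
    using c by (simp add: y_def)
  obtain r l where "strict_mono r" "l \<noteq> 0" "weakly_converges (\<lambda>k. x (r k) /\<^sub>R norm (x (r k))) l"
    by (rule weakly_narrowE[OF A y lim, unfolded eq])
  then show "\<exists>r l. strict_mono r \<and> l \<noteq> 0 \<and> weakly_converges (\<lambda>k. x (r k) /\<^sub>R norm (x (r k))) l"
    by blast
qed

section \<open>Cancellation\<close>
text \<open>Starting from some \<open>b\<^sub>0\<close>, write \<open>a + b\<^sub>n\<close> as \<open>b\<^sub>n\<^sub>+\<^sub>1 + c\<^sub>n\<close> up to an error of \<open>2\<^sup>-\<^sup>n\<close> and add up these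
relations. The terms \<open>b\<^sub>n\<close> telescope and the errors have sum at most two, so that \<open>n a + b\<^sub>0\<close> differs from
\<open>b\<^sub>n\<close> plus \<open>n\<close> times a mean of points of \<^term>\<open>C\<close> by at most two. The sequence \<^term>\<open>b\<close> of the conclusion
starts with \<open>b\<^sub>1\<close>.\<close>
lemma iterated_absorption:
  fixes B C :: "'a::real_normed_vector set"
  assumes sub: "(+) a ` B \<subseteq> closure (B + C)" and "B \<noteq> {}" and "convex C"
  obtains b m b0 where "\<And>n. b n \<in> B" and "\<And>n. m n \<in> C"
    and "\<And>n. norm (real (Suc n) *\<^sub>R (a - m n) + b0 - b n) \<le> 2"
proof -
  define P where "P n b b' c \<longleftrightarrow> c \<in> C \<and> norm (a + b - b' - c) \<le> (1/2) ^ n" for n b b' c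
  have step: "\<exists>b'. b' \<in> B \<and> (\<exists>c. P n b b' c)" if "b \<in> B" for b n
  proof -
    have "a + b \<in> closure (B + C)" and "0 < (1/2 :: real) ^ n"
      using sub that by auto
    then obtain y where "y \<in> B + C" and y: "dist y (a + b) < (1/2) ^ n"
      unfolding closure_approachable by meson
    then obtain b' c where "b' \<in> B" "c \<in> C" "y = b' + c"
      by (meson set_plus_elim)
    moreover from this y have "norm (a + b - b' - c) \<le> (1/2) ^ n"
      by (simp add: dist_norm norm_minus_commute diff_diff_eq)
    ultimately show ?thesis
      by (auto simp: P_def)
  qed
  from \<open>B \<noteq> {}\<close> have "\<exists>b. b \<in> B" by blast
  from dependent_nat_choice[of "\<lambda>_ b. b \<in> B" "\<lambda>n b b'. \<exists>c. P n b b' c", OF this step]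
  obtain b where b: "\<And>n. b n \<in> B" and "\<And>n. \<exists>c. P n (b n) (b (Suc n)) c"
    by blast
  then obtain c where "\<And>n. P n (b n) (b (Suc n)) (c n)"
    by metis
  then have c: "\<And>n. c n \<in> C" and err: "\<And>n. norm (a + b n - b (Suc n) - c n) \<le> (1/2) ^ n"
    by (auto simp: P_def)
  \<comment> \<open>The bound is the partial sum of the errors, \<open>1 + 1/2 + \<dots> + 1/2\<^sup>n\<^sup>-\<^sup>1\<close>.\<close>
  have tele: "norm (real n *\<^sub>R a - (\<Sum>i<n. c i) + b 0 - b n) \<le> 2 - 2 * (1/2) ^ n" for n
  proof (induction n)
    case (Suc n)
    have "real (Suc n) *\<^sub>R a - (\<Sum>i<Suc n. c i) + b 0 - b (Suc n)
        = (real n *\<^sub>R a - (\<Sum>i<n. c i) + b 0 - b n) + (a + b n - b (Suc n) - c n)"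
      by (simp add: scaleR_add_left)
    also have "norm \<dots> \<le> (2 - 2 * (1/2) ^ n) + (1/2) ^ n"
      by (intro norm_triangle_le add_mono Suc.IH err)
    finally show ?case by simp
  qed simp
  define m where "m n = (\<Sum>i<Suc n. (1 / real (Suc n)) *\<^sub>R c i)" for n
  have "m n \<in> C" for n
    unfolding m_def using c by (intro convex_sum \<open>convex C\<close>) auto
  moreover have "norm (real (Suc n) *\<^sub>R (a - m n) + b 0 - b (Suc n)) \<le> 2" for n
  proof -
    have "real (Suc n) *\<^sub>R m n = (\<Sum>i<Suc n. c i)"
      unfolding m_def scaleR_sum_right[symmetric] by (simp del: sum.lessThan_Suc of_nat_Suc)
    then have "real (Suc n) *\<^sub>R (a - m n) + b 0 - b (Suc n) = real (Suc n) *\<^sub>R a - (\<Sum>i<Suc n. c i) + b 0 - b (Suc n)"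
      by (simp only: scaleR_diff_right)
    also have "norm \<dots> \<le> 2 - 2 * (1/2) ^ Suc n"
      by (rule tele)
    also have "\<dots> \<le> 2" by simp
    finally show ?thesis .
  qed
  ultimately show thesis
    using that[of "\<lambda>n. b (Suc n)" m "b 0"] b by blast
qed

text \<open>Divide the relation between \<open>a\<close>, the means \<open>m\<^sub>n\<close> and the points \<open>b\<^sub>n\<close> by the scale \<open>s\<^sub>n\<close>, which is
the sum of \<open>n + 1\<close> and the norm of \<open>b\<^sub>n\<close>. Along a subsequence \<open>b\<^sub>n / s\<^sub>n\<close> tends weakly to some \<open>v\<close> in
\<^term>\<open>V\<close>, the factor \<open>\<rho>\<^sub>n = (n + 1) / s\<^sub>n\<close> tends to some \<open>\<tau>\<close>, and \<open>\<rho>\<^sub>n m\<^sub>n\<close> tends weakly to \<open>\<tau> a - v\<close>.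

If \<open>\<tau> = 0\<close>, then \<open>b\<^sub>n\<close> dominates the scale, so \<open>v \<noteq> 0\<close>, while \<open>- v\<close> is a recession direction of \<^term>\<open>C\<close>;
this contradicts pointedness. If \<open>\<tau> > 0\<close>, then the means tend weakly to \<open>a - v / \<tau>\<close>. This point lies in
\<^term>\<open>C\<close>, and adding the recession direction \<open>v / \<tau>\<close> shows that \<open>a\<close> does.\<close>
lemma order_cancellation:
  assumes B: "closed B" "convex B" "weakly_narrow B" "recession_cone B = V" "B \<noteq> {}"
    and C: "closed C" "convex C" "recession_cone C = V"
    and V: "pointed V"
    and sub: "closed_sum A B \<subseteq> closed_sum B C"
  shows "A \<subseteq> C"
proof
  fix a assume "a \<in> A"
  then have mem: "(+) a ` B \<subseteq> closure (B + C)"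
    using sub closure_subset[of "A + B"] unfolding closed_sum_def by blast
  obtain b m b0 where b: "\<And>n. b n \<in> B" and m: "\<And>n. m n \<in> C"
    and err: "\<And>n. norm (real (Suc n) *\<^sub>R (a - m n) + b0 - b n) \<le> 2"
    by (rule iterated_absorption[OF mem B(5) C(2)]) (rule that)
  define s where "s n = norm (b n) + real (Suc n)" for n
  have s: "filterlim s at_top sequentially"
    by (rule filterlim_at_top_mono[OF filterlim_real_sequentially always_eventually]) (simp add: s_def)
  have s_pos: "0 < s n" for n
    by (simp add: s_def add_nonneg_pos)
  obtain r v \<theta> where r: "strict_mono r" and v: "weakly_converges (\<lambda>n. b (r n) /\<^sub>R s (r n)) v"
    and \<theta>: "(\<lambda>n. norm (b (r n)) / s (r n)) \<longlonglongrightarrow> \<theta>" and v0: "v = 0 \<Longrightarrow> \<theta> = 0" and vV: "v \<in> V"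
    by (rule narrow_scaled_limit[OF B(1-3), unfolded B(4), where x = b, OF b _ s]) (simp_all add: s_def)
  \<comment> \<open>\<^term>\<open>\<theta>\<close> is the share of \<^term>\<open>b\<close> in the scale, and \<open>\<tau>\<close> the share of the index.\<close>
  define \<tau> where "\<tau> = 1 - \<theta>"
  define \<rho> where "\<rho> n = real (Suc (r n)) / s (r n)" for n
  have \<rho>_pos: "0 < \<rho> n" for n
    using s_pos by (simp add: \<rho>_def)
  have "\<rho> n = 1 - norm (b (r n)) / s (r n)" for n
    using s_pos[of "r n"] by (simp add: \<rho>_def s_def field_simps)
  then have "\<rho> = (\<lambda>n. 1 - norm (b (r n)) / s (r n))"
    by (rule ext)
  then have \<rho>: "\<rho> \<longlonglongrightarrow> \<tau>"
    using tendsto_diff[OF tendsto_const \<theta>, of 1] by (simp add: \<tau>_def)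
  have err': "norm (b n - real (Suc n) *\<^sub>R (a - m n)) \<le> 2 + norm b0" for n
    using norm_triangle_ineq4[of b0 "real (Suc n) *\<^sub>R (a - m n) + b0 - b n"] err[of n]
    by (simp add: algebra_simps del: of_nat_Suc)
  have "filterlim (\<lambda>n. s (r n)) at_top sequentially"
    by (rule filterlim_compose[OF s filterlim_subseq[OF r]])
  then have small: "(\<lambda>n. (b (r n) - real (Suc (r n)) *\<^sub>R (a - m (r n))) /\<^sub>R s (r n)) \<longlonglongrightarrow> 0"
    by (rule bounded_div_at_top_tendsto_0) (rule err')
  \<comment> \<open>The last summand is the scaled error; the three of them add up to \<open>\<rho>\<^sub>n m\<^sub>n\<close>.\<close>
  have "weakly_converges (\<lambda>n. \<rho> n *\<^sub>R a + - (b (r n) /\<^sub>R s (r n))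
      + (b (r n) - real (Suc (r n)) *\<^sub>R (a - m (r n))) /\<^sub>R s (r n)) (\<tau> *\<^sub>R a + - v + 0)"
    by (intro weakly_converges_add weakly_converges_minus weakly_converges_scaleR \<rho> v
        tendsto_weakly_converges[OF small] tendsto_weakly_converges[OF tendsto_const])
  moreover have "\<rho> n *\<^sub>R a + - (b (r n) /\<^sub>R s (r n))
      + (b (r n) - real (Suc (r n)) *\<^sub>R (a - m (r n))) /\<^sub>R s (r n) = \<rho> n *\<^sub>R m (r n)" for n
    by (simp add: \<rho>_def scaleR_diff_right divide_inverse_commute del: of_nat_Suc)
  ultimately have lim: "weakly_converges (\<lambda>n. \<rho> n *\<^sub>R m (r n)) (\<tau> *\<^sub>R a - v)"
    by simp
  show "a \<in> C"
  proof (cases "\<tau> = 0")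
    case True
    with lim have "weakly_converges (\<lambda>n. \<rho> n *\<^sub>R m (r n)) (- v)"
      by simp
    then have "- v \<in> V"
      unfolding C(3)[symmetric]
      by (rule weak_limit_in_recession_cone[OF C(1,2) m less_imp_le[OF \<rho>_pos] \<rho>[unfolded True]])
    with pointedD[OF V vV] have "v = 0" by simp
    with v0 True show ?thesis by (simp add: \<tau>_def)
  next
    case False
    have "0 \<le> \<tau>"
      by (rule LIMSEQ_le_const[OF \<rho>]) (auto intro: less_imp_le[OF \<rho>_pos])
    with False have "0 < \<tau>" by simp
    have "weakly_converges (\<lambda>n. inverse (\<rho> n) *\<^sub>R (\<rho> n *\<^sub>R m (r n))) (inverse \<tau> *\<^sub>R (\<tau> *\<^sub>R a - v))"
      by (intro weakly_converges_scaleR tendsto_inverse \<rho> lim False)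
    moreover have "inverse (\<rho> n) *\<^sub>R (\<rho> n *\<^sub>R m (r n)) = m (r n)" for n
      using \<rho>_pos[of n] by simp
    ultimately have "weakly_converges (\<lambda>n. m (r n)) (a - inverse \<tau> *\<^sub>R v)"
      using False by (simp add: scaleR_diff_right)
    then have "a - inverse \<tau> *\<^sub>R v \<in> C"
      by (rule weakly_converges_mem[OF C(1,2)]) (simp add: m)
    with vV \<open>0 < \<tau>\<close> have "(a - inverse \<tau> *\<^sub>R v) + inverse \<tau> *\<^sub>R v \<in> C"
      unfolding C(3)[symmetric] by (intro recession_coneD) simp_all
    then show ?thesis by simp
  qed
qed

section \<open>The cone of weakly narrow sets\<close>
lemma closed_sum_in_narrow_family:
  assumes "convex V" "cone V" "pointed V" and A: "A \<in> narrow_family V" and B: "B \<in> narrow_family V"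
  shows "closed_sum A B \<in> narrow_family V"
proof -
  from A have A': "A \<noteq> {}" "closed A" "convex A" "weakly_narrow A" "recession_cone A = V"
    by (auto simp: narrow_family_def)
  from B have B': "B \<noteq> {}" "closed B" "convex B" "weakly_narrow B" "recession_cone B = V"
    by (auto simp: narrow_family_def)
  from A'(1) B'(1) have "A + B \<noteq> {}"
    by blast
  moreover have "closed (closed_sum A B)" "convex (closed_sum A B)"
    using A'(3) B'(3) by (auto simp: closed_sum_def convex_set_plus)
  moreover have "weakly_narrow (closed_sum A B)"
    by (rule weakly_narrow_closed_sum[OF A'(2-5) B'(2-5) assms(1-3)])
  moreover have "recession_cone (closed_sum A B) = V"
    using recession_cone_closed_sum_subset[OF A'(2-5,1) B'(2-5,1) assms(1-3)]
      recession_cone_closed_sum_superset[of A B] A'(5) by simp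
  ultimately show ?thesis
    by (simp add: narrow_family_def closed_sum_def)
qed

lemma scaled_in_narrow_family:
  assumes "A \<in> narrow_family V" and "0 < c"
  shows "(\<lambda>a. c *\<^sub>R a) ` A \<in> narrow_family V"
  using assms
  by (simp add: narrow_family_def weakly_narrow_scaled recession_cone_scaled closed_scaling convex_scaling)

lemma cone_in_narrow_family:
  assumes "closed V" "convex V" "cone V" "pointed V" and A: "A \<in> narrow_family V"
  shows "V \<in> narrow_family V"
proof -
  have "0 \<in> V"
    using \<open>pointed V\<close> by (auto simp: pointed_def)
  moreover from A obtain a where "a \<in> A" "weakly_narrow A" "recession_cone A = V"
    by (auto simp: narrow_family_def)
  then have "weakly_narrow V"
    using weakly_narrow_recession_cone[of A a] by simp
  ultimately show ?thesis
    using assms(1-3) recession_cone_of_convex_cone[of V] by (auto simp: narrow_family_def)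
qed

lemma closed_sum_commute: "closed_sum A B = closed_sum B A"
  by (simp add: closed_sum_def add.commute)

lemma closed_sum_closure_left: "closed_sum (closure A) B = closed_sum A B"
proof
  have "closure A + B \<subseteq> closure A + closure B"
    by (intro set_plus_mono2 closure_subset order_refl)
  also have "\<dots> \<subseteq> closure (A + B)"
    by (rule closure_sum)
  finally show "closed_sum (closure A) B \<subseteq> closed_sum A B"
    unfolding closed_sum_def by (rule closure_minimal) simp
  show "closed_sum A B \<subseteq> closed_sum (closure A) B"
    unfolding closed_sum_def by (intro closure_mono set_plus_mono2 closure_subset order_refl)
qed

lemma closed_sum_assoc: "closed_sum (closed_sum A B) C = closed_sum A (closed_sum B C)"
proof -
  have "closed_sum (closed_sum A B) C = closure (A + B + C)" for A B C :: "'a set"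
    using closed_sum_closure_left[of "A + B" C] by (simp add: closed_sum_def)
  from this[of A B C] this[of B C A] show ?thesis
    by (simp add: closed_sum_commute[of A] add.commute add.left_commute)
qed

lemma closed_sum_recession_cone:
  assumes "closed A"
  shows "closed_sum A (recession_cone A) = A"
proof
  have "A + recession_cone A \<subseteq> A"
    using recession_coneD[of _ A _ 1] by (auto elim!: set_plus_elim)
  then show "closed_sum A (recession_cone A) \<subseteq> A"
    unfolding closed_sum_def by (rule closure_minimal[OF _ assms])
  have "A \<subseteq> A + recession_cone A"
    using set_plus_intro[OF _ zero_in_recession_cone] by fastforce
  then show "A \<subseteq> closed_sum A (recession_cone A)"
    unfolding closed_sum_def using closure_subset by blast
qed

lemma scaled_closed_sum:
  "(\<lambda>x. c *\<^sub>R x) ` closed_sum A B = closed_sum ((\<lambda>x. c *\<^sub>R x) ` A) ((\<lambda>x. c *\<^sub>R x) ` B)"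
proof -
  have "(\<lambda>x. c *\<^sub>R x) ` (A + B) = (\<lambda>x. c *\<^sub>R x) ` A + (\<lambda>x. c *\<^sub>R x) ` B"
    by (force simp: set_plus_def scaleR_add_right)
  then show ?thesis
    by (simp add: closed_sum_def closure_scaleR)
qed

text \<open>The distributive law over scalars: \<^term>\<open>\<alpha> *\<^sub>R x + \<beta> *\<^sub>R y\<close> is \<^term>\<open>\<alpha> + \<beta>\<close> times a convex combination of
\<^term>\<open>x\<close> and \<^term>\<open>y\<close>.\<close>
lemma convex_scaled_add:
  assumes "convex A" and "0 < \<alpha>" and "0 < \<beta>"
  shows "(\<lambda>x. \<alpha> *\<^sub>R x) ` A + (\<lambda>x. \<beta> *\<^sub>R x) ` A = (\<lambda>x. (\<alpha> + \<beta>) *\<^sub>R x) ` A"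
proof (intro equalityI subsetI)
  fix z assume "z \<in> (\<lambda>x. \<alpha> *\<^sub>R x) ` A + (\<lambda>x. \<beta> *\<^sub>R x) ` A"
  then obtain x y where xy: "x \<in> A" "y \<in> A" and z: "z = \<alpha> *\<^sub>R x + \<beta> *\<^sub>R y"
    by (auto elim!: set_plus_elim)
  let ?m = "(\<alpha> / (\<alpha> + \<beta>)) *\<^sub>R x + (\<beta> / (\<alpha> + \<beta>)) *\<^sub>R y"
  have "?m \<in> A"
    using xy assms by (intro convexD[OF \<open>convex A\<close>]) (simp_all add: add_divide_distrib[symmetric])
  moreover have "z = (\<alpha> + \<beta>) *\<^sub>R ?m"
    using z assms by (simp add: scaleR_add_right)
  ultimately show "z \<in> (\<lambda>x. (\<alpha> + \<beta>) *\<^sub>R x) ` A"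
    by (rule rev_image_eqI)
next
  fix z assume "z \<in> (\<lambda>x. (\<alpha> + \<beta>) *\<^sub>R x) ` A"
  then show "z \<in> (\<lambda>x. \<alpha> *\<^sub>R x) ` A + (\<lambda>x. \<beta> *\<^sub>R x) ` A"
    by (auto simp: scaleR_add_left)
qed

lemma scaled_cone:
  assumes "cone V" and "0 < c"
  shows "(\<lambda>x. c *\<^sub>R x) ` V = V"
proof (intro equalityI subsetI)
  fix x assume "x \<in> V"
  then have "inverse c *\<^sub>R x \<in> V"
    using assms by (simp add: cone_def)
  moreover have "x = c *\<^sub>R (inverse c *\<^sub>R x)"
    using assms by simp
  ultimately show "x \<in> (\<lambda>x. c *\<^sub>R x) ` V"
    by (rule rev_image_eqI)
qed (use assms in \<open>auto simp: cone_def\<close>)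

theorem theorem4p16:
  fixes V :: "'a::real_normed_vector set"
  assumes "closed V" and "convex V" and "cone V" and "pointed V"
    and "narrow_family V \<noteq> {}"
  shows "abstract_convex_cone (narrow_family V) closed_sum (set_scale V) V \<and>
    (\<forall>A\<in>narrow_family V. \<forall>B\<in>narrow_family V. \<forall>C\<in>narrow_family V.
      closed_sum A B = closed_sum B C \<longrightarrow> A = C)"
proof
  have V: "V \<in> narrow_family V"
    using assms cone_in_narrow_family by blast
  have add_V: "closed_sum A V = A" if "A \<in> narrow_family V" for A
    using that closed_sum_recession_cone[of A] by (auto simp: narrow_family_def)
  show "abstract_convex_cone (narrow_family V) closed_sum (set_scale V) V"
  proof
    fix A B C and \<alpha> \<beta> :: real
    assume A: "A \<in> narrow_family V"
    show "closed_sum A V = A"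
      by (rule add_V[OF A])
    show "set_scale V 1 A = A" "set_scale V 0 A = V"
      by (simp_all add: set_scale_def)
    assume \<alpha>: "0 \<le> \<alpha>"
    show "set_scale V \<alpha> A \<in> narrow_family V"
      using A V \<alpha> scaled_in_narrow_family[of A V \<alpha>] by (simp add: set_scale_def)
    show "set_scale V \<alpha> (closed_sum A B) = closed_sum (set_scale V \<alpha> A) (set_scale V \<alpha> B)"
      using add_V[OF V] by (simp add: set_scale_def scaled_closed_sum)
    assume \<beta>: "0 \<le> \<beta>"
    show "set_scale V \<alpha> (set_scale V \<beta> A) = set_scale V (\<alpha> * \<beta>) A"
      using \<alpha> scaled_cone[OF \<open>cone V\<close>, of \<alpha>] by (auto simp: set_scale_def image_image)
    show "set_scale V (\<alpha> + \<beta>) A = closed_sum (set_scale V \<alpha> A) (set_scale V \<beta> A)"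
    proof (cases "\<alpha> = 0 \<or> \<beta> = 0")
      case True
      have "set_scale V c A \<in> narrow_family V" if "0 \<le> c" for c
        using A V that scaled_in_narrow_family[of A V c] by (simp add: set_scale_def)
      then have "closed_sum (set_scale V c A) V = set_scale V c A" if "0 \<le> c" for c
        using add_V that by blast
      with True \<alpha> \<beta> show ?thesis
        by (auto simp: set_scale_def[of V 0] closed_sum_commute[of V])
    next
      case False
      with \<alpha> \<beta> have pos: "0 < \<alpha>" "0 < \<beta>" by simp_all
      from A have "closed A" "convex A"
        by (auto simp: narrow_family_def)
      with pos show ?thesis
        by (simp add: set_scale_def closed_sum_def convex_scaled_add closed_scaling closure_closed)
    qed
  next
    fix A B
    assume "A \<in> narrow_family V" and "B \<in> narrow_family V"
    then show "closed_sum A B \<in> narrow_family V"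
      by (rule closed_sum_in_narrow_family[OF assms(2-4)])
  qed (rule V closed_sum_assoc closed_sum_commute)+
  show "\<forall>A\<in>narrow_family V. \<forall>B\<in>narrow_family V. \<forall>C\<in>narrow_family V.
      closed_sum A B = closed_sum B C \<longrightarrow> A = C"
  proof (intro ballI impI)
    fix A B C
    assume fam: "A \<in> narrow_family V" "B \<in> narrow_family V" "C \<in> narrow_family V"
      and eq: "closed_sum A B = closed_sum B C"
    from fam have *: "closed B" "convex B" "weakly_narrow B" "recession_cone B = V" "B \<noteq> {}"
      and A: "closed A" "convex A" "recession_cone A = V"
      and C: "closed C" "convex C" "recession_cone C = V"
      by (auto simp: narrow_family_def)
    show "A = C"
    proof
      show "A \<subseteq> C"
        by (rule order_cancellation[OF * C \<open>pointed V\<close>]) (simp add: eq)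
      show "C \<subseteq> A"
        by (rule order_cancellation[OF * A \<open>pointed V\<close>])
          (simp add: eq closed_sum_commute[of C B] closed_sum_commute[of B A])
    qed
  qed
qed

end
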